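(* Let $n,p\in\mathbb N$, let $\lambda\ge\mu\ge 0$, $l\ge 0$, $\delta\ge0$ be real, and let $-1\le A<B\le 1$, $0<B\le 1$, $0\le\sigma<p$. Let $f(z)=z^p-\sum_{k=n+p}^\infty|a_k|z^k\in\mathcal A(n,p)$ and let $\kappa_m(z)$ be its partial sums $$\kappa_m(z)=\begin{cases}z^p, & m=1,2,\dots,n+p-1,\\ z^p-\sum_{k=n+p}^m|a_k|z^k,& m=n+p,n+p+1,\dots.\end{cases}$$ Suppose that $$\sum_{k=n+p}^\infty\theta_k|a_k|\le1,\qquad\text{where }\ \theta_k=\frac{k(1+B)\Phi_p^k(\delta,\lambda,\mu,l)}{(B-A)(p-\sigma)}.$$ Then for $m\ge n+p$ and all $z\in\mathcal U$, $$\Re\left(\frac{f(z)}{\kappa_m(z)}\right)>1-\frac1{\theta_{m+1}}\qquad\text{and}\qquad \Re\left(\frac{\kappa_m(z)}{f(z)}\right)>\frac{\theta_{m+1}}{1+\theta_{m+1}}.$$ The results are sharp for every $m\ge n+p$ (neither lower bound can be replaced by a larger constant), with the extremal function $$f(z)=z^p-\frac1{\theta_{m+1}}z^{m+1}.$$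
   Context: $\mathbb N=\{1,2,3,\dots\}$ and $\mathcal U=\{z\in\mathbb C:|z|<1\}$. $\mathcal A(n,p)$ is the class of functions $f(z)=z^p+\sum_{k=n+p}^\infty a_kz^k$ that are analytic and $p$-valent in $\mathcal U$ ($p$-valent: no value is taken more than $p$ times in $\mathcal U$, counted with multiplicity, and some value is taken exactly $p$ times). For $k\ge n+p$, $$\Phi_p^k(\delta,\lambda,\mu,l)=\left[\frac{(k-p)(\lambda\mu k+\lambda-\mu)+p+l}{p+l}\right]^{\delta}.$$ The quotients $f/\kappa_m$ and $\kappa_m/f$ are extended to $z=0$ by their limit value $1$. *)

theory Defs
  imports "HOL-Complex_Analysis.Complex_Analysis"
begin

abbreviation unit_disc :: "complex set" where
  "unit_disc \<equiv> ball 0 1"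

definition preimages :: "(complex \<Rightarrow> complex) \<Rightarrow> complex \<Rightarrow> complex set" where
  "preimages f w = {z \<in> unit_disc. f z = w}"

text \<open>The finiteness conditions are needed because a sum over an infinite set is 0 by convention.
  They also exclude constant functions, so that \<open>zorder (\<lambda>u. f u - w) z\<close> really is the
  multiplicity of the solution \<open>z\<close> of \<open>f z = w\<close>.\<close>
definition p_valent :: "nat \<Rightarrow> (complex \<Rightarrow> complex) \<Rightarrow> bool" where
  "p_valent p f \<longleftrightarrow>
     (\<forall>w. finite (preimages f w) \<and>
          (\<Sum>z\<in>preimages f w. zorder (\<lambda>u. f u - w) z) \<le> int p) \<and>
     (\<exists>w. (\<Sum>z\<in>preimages f w. zorder (\<lambda>u. f u - w) z) = int p)"

text \<open>Series starting at \<open>k = n + p\<close> are written with the summation index shifted by \<open>n + p\<close>.\<close>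
definition class_A :: "nat \<Rightarrow> nat \<Rightarrow> (complex \<Rightarrow> complex) set" where
  "class_A n p = {f. f analytic_on unit_disc \<and> p_valent p f \<and>
     (\<exists>a :: nat \<Rightarrow> complex. \<forall>z\<in>unit_disc.
        (\<lambda>j. a (j + (n + p)) * z ^ (j + (n + p))) sums (f z - z ^ p))}"

definition Phi :: "nat \<Rightarrow> real \<Rightarrow> real \<Rightarrow> real \<Rightarrow> real \<Rightarrow> nat \<Rightarrow> real" where
  "Phi p \<delta> lam \<mu> l k =
     (((real k - real p) * (lam * \<mu> * real k + lam - \<mu>) + real p + l) / (real p + l)) powr \<delta>"

definition theta ::
  "nat \<Rightarrow> real \<Rightarrow> real \<Rightarrow> real \<Rightarrow> real \<Rightarrow> real \<Rightarrow> real \<Rightarrow> real \<Rightarrow> nat \<Rightarrow> real" where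
  "theta p \<delta> lam \<mu> l A B \<sigma> k =
     (real k * (1 + B) * Phi p \<delta> lam \<mu> l k) / ((B - A) * (real p - \<sigma>))"

text \<open>\<open>f\<close> lies in the class and has the form $z^p - \sum_{k \ge n+p} |a_k| z^k$.\<close>
definition neg_coeff_function ::
  "nat \<Rightarrow> nat \<Rightarrow> (nat \<Rightarrow> complex) \<Rightarrow> (complex \<Rightarrow> complex) \<Rightarrow> bool" where
  "neg_coeff_function n p a f \<longleftrightarrow> f \<in> class_A n p \<and>
     (\<forall>z\<in>unit_disc.
        (\<lambda>j. of_real (cmod (a (j + (n + p)))) * z ^ (j + (n + p))) sums (z ^ p - f z))"

text \<open>\<open>\<Sum>k\<ge>n+p. t k * |a k| \<le> 1\<close>, convergence included.\<close>
definition weighted_coeff_bound ::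
  "nat \<Rightarrow> nat \<Rightarrow> (nat \<Rightarrow> real) \<Rightarrow> (nat \<Rightarrow> complex) \<Rightarrow> bool" where
  "weighted_coeff_bound n p t a \<longleftrightarrow>
     summable (\<lambda>j. t (j + (n + p)) * cmod (a (j + (n + p)))) \<and>
     (\<Sum>j. t (j + (n + p)) * cmod (a (j + (n + p)))) \<le> 1"

definition kappa :: "nat \<Rightarrow> nat \<Rightarrow> (nat \<Rightarrow> complex) \<Rightarrow> nat \<Rightarrow> complex \<Rightarrow> complex" where
  "kappa n p a m z =
     (if m < n + p then z ^ p
      else z ^ p - (\<Sum>k=n+p..m. of_real (cmod (a k)) * z ^ k))"

text \<open>The quotient, extended to the origin by its limit value 1 (both functions are
  \<open>z ^ p * (1 + o(1))\<close> there).\<close>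
definition ext_quotient :: "(complex \<Rightarrow> complex) \<Rightarrow> (complex \<Rightarrow> complex) \<Rightarrow> complex \<Rightarrow> complex" where
  "ext_quotient f g z = (if z = 0 then 1 else f z / g z)"

definition extremal_fun :: "nat \<Rightarrow> (nat \<Rightarrow> real) \<Rightarrow> nat \<Rightarrow> complex \<Rightarrow> complex" where
  "extremal_fun p t m z = z ^ p - of_real (1 / t (m + 1)) * z ^ (m + 1)"

definition extremal_coeff :: "(nat \<Rightarrow> real) \<Rightarrow> nat \<Rightarrow> nat \<Rightarrow> complex" where
  "extremal_coeff t m k = (if k = m + 1 then of_real (1 / t (m + 1)) else 0)"

end

theory Submission
  imports Defs
begin

text \<open>Write \<open>K\<close> for the partial sum of \<open>f\<close> at a point \<open>z \<noteq> 0\<close> of the disc, \<open>R = K - f\<close> for the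
  remaining tail and \<open>t = \<theta> (m + 1)\<close>. The weights \<open>\<theta> k\<close> exceed 1 and increase with \<open>k\<close>,
  so the hypothesis on the coefficients gives
  $\sum_{k \le m} |a_k| + t \sum_{k > m} |a_k| \le 1$, and since every power of \<open>z\<close> in \<open>f\<close> after
  the leading one is at least the \<open>(p + 1)\<close>-st, this forces \<open>t * |R| < |K|\<close> (\<open>tail_less_partial_sum\<close>). Hence
  \<open>w = R / K\<close> satisfies \<open>|w| < 1 / t < 1\<close>, and both bounds are statements about the real parts of
  \<open>f / K = 1 - w\<close> and \<open>K / f = 1 / (1 - w)\<close> (\<open>Re_quotients_gt\<close>).

  For the extremal function the partial sum is $z^p$, so that \<open>w\<close> is $z^{m+1-p} / t$ and takes every
  value of the disc of radius \<open>1 / t\<close>. Letting \<open>w\<close> tend to \<open>1 / t\<close> and to \<open>-1 / t\<close> along the real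
  axis shows that neither bound can be improved.

  What remains is that the extremal function, a binomial $z^p - c z^q$ with \<open>q * c \<le> p < q\<close>, is
  \<open>p\<close>-valent (\<open>p_valent_binomial\<close>). It is the \<open>p\<close>-th power of
  $g(z) = z (1 - c z^{q-p})^{1/p}$, whose derivative has positive real part on the disc; hence \<open>g\<close> is injective
  and a nonzero value is taken at no more points than it has \<open>p\<close>-th roots, that is, at most \<open>p\<close>. The derivative of the
  binomial has no zero in the disc except possibly the origin, so all those solutions are simple, while the value 0 is
  taken at the origin only, with multiplicity \<open>p\<close>.\<close>

section \<open>A lacunary binomial is p-valent\<close>

text \<open>The Noshiro--Warschawski criterion: divided by \<open>z - w\<close>, the increment of \<open>g\<close> along the segment from
  \<open>w\<close> to \<open>z\<close> has the real part of some value of the derivative, so it cannot vanish.\<close>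

lemma inj_on_if_Re_derivative_pos:
  fixes g g' :: "complex \<Rightarrow> complex"
  assumes "convex S"
    and deriv: "\<And>z. z \<in> S \<Longrightarrow> (g has_field_derivative g' z) (at z)"
    and pos: "\<And>z. z \<in> S \<Longrightarrow> Re (g' z) > 0"
  shows "inj_on g S"
proof (rule inj_onI, rule ccontr)
  fix z w assume zw: "z \<in> S" "w \<in> S" "g z = g w" "z \<noteq> w"
  have seg: "closed_segment w z \<subseteq> S"
    using \<open>convex S\<close> zw by (simp add: closed_segment_subset)
  have "\<exists>u. u \<in> closed_segment w z \<and>
          Re (g z / (z - w)) - Re (g w / (z - w)) = Re (g' u / (z - w) * (z - w))"
    by (rule complex_mvt_line) (use deriv seg in \<open>auto intro!: DERIV_cdivide\<close>)
  then obtain u where "u \<in> S" "Re (g' u) = 0"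
    using seg zw by auto
  then show False using pos by fastforce
qed

text \<open>This is $\mathrm{Re}(a^{-s} b) > 0$ for the principal power. The argument of the product is
  \<open>arg b - s * arg a\<close>, a difference of two numbers of the same sign that are both smaller than \<open>\<pi> / 2\<close>
  in absolute value; it is therefore again smaller than \<open>\<pi> / 2\<close>.\<close>

lemma Re_principal_power_mult_pos:
  fixes a b :: complex and s :: real
  assumes a: "Re a > 0" and b: "Re b > 0" and same: "sgn (Im a) = sgn (Im b)"
    and s: "0 \<le> s" "s \<le> 1"
  shows "Re (exp (- (of_real s * Ln a)) * b) > 0"
proof -
  have nz: "a \<noteq> 0" "b \<noteq> 0" using a b by auto
  have ba: "\<bar>Im (Ln a)\<bar> < pi / 2" "\<bar>Im (Ln b)\<bar> < pi / 2"
    using Re_Ln_pos_lt_imp a b by blast+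
  have sgn: "(Im (Ln x) \<ge> 0 \<longleftrightarrow> Im x \<ge> 0) \<and> (Im (Ln x) = 0 \<longleftrightarrow> Im x = 0)" if "Re x > 0" for x
  proof -
    have x: "x \<noteq> 0" using that by auto
    have "Im (Ln x) \<le> pi" using Re_Ln_pos_lt_imp[OF that] pi_gt_zero by linarith
    then show ?thesis using that Im_Ln_pos_le[OF x] Im_Ln_eq_0[OF x] by simp
  qed
  have "\<bar>Im (Ln b) - s * Im (Ln a)\<bar> < pi / 2"
  proof (cases "Im (Ln a) \<ge> 0")
    case True
    then have "Im a \<ge> 0" using sgn a by blast
    then have "Im b \<ge> 0" using same
      by (auto simp: sgn_if split: if_splits)
    then have "Im (Ln b) \<ge> 0" using sgn b by blast
    moreover have "0 \<le> s * Im (Ln a)" "s * Im (Ln a) \<le> Im (Ln a)"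
      using True s by (auto simp: mult_left_le_one_le)
    ultimately show ?thesis using ba by linarith
  next
    case False
    then have "Im a < 0" using sgn a by (meson not_le)
    then have "Im b < 0" using same
      by (auto simp: sgn_if split: if_splits)
    then have "Im (Ln b) < 0" using sgn b by (meson not_le)
    moreover have "s * Im (Ln a) \<le> 0" "Im (Ln a) \<le> s * Im (Ln a)"
      using False s mult_right_mono_neg[of s 1 "Im (Ln a)"]
      by (auto simp: mult_nonneg_nonpos)
    ultimately show ?thesis using ba by linarith
  qed
  then have "cos (Im (Ln b) - s * Im (Ln a)) > 0"
    by (intro cos_gt_zero_pi) linarith+
  moreover have "exp (- (of_real s * Ln a)) * b = exp (Ln b - of_real s * Ln a)"
    using nz by (simp add: exp_diff exp_minus field_simps)
  ultimately show ?thesis by (simp add: Re_exp)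
qed

text \<open>A holomorphic branch of the \<open>p\<close>-th root of $z^p - c z^{p+d}$ on the unit disc when \<open>0 \<le> c \<le> 1\<close>.\<close>

definition binomial_root :: "nat \<Rightarrow> nat \<Rightarrow> real \<Rightarrow> complex \<Rightarrow> complex" where
  "binomial_root p d c z = z * exp (Ln (1 - of_real c * z ^ d) / of_nat p)"

lemma Re_one_minus_pos:
  assumes "0 \<le> c" "c \<le> 1" "d \<ge> 1" "z \<in> unit_disc"
  shows "Re (1 - of_real c * z ^ d) > 0"
proof -
  have "cmod z ^ d < 1" using assms by (simp add: power_less_one_iff)
  moreover have "c * cmod z ^ d \<le> 1 * cmod z ^ d"
    using assms by (intro mult_right_mono) auto
  ultimately have "cmod (of_real c * z ^ d) < 1"
    using assms by (simp add: norm_mult norm_power)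
  then show ?thesis
    using complex_Re_le_cmod[of "of_real c * z ^ d"] by simp
qed

lemma binomial_root_power:
  assumes "p \<ge> 1" "1 - of_real c * z ^ d \<noteq> 0"
  shows "binomial_root p d c z ^ p = z ^ p - of_real c * z ^ (p + d)"
  using assms
  by (simp add: binomial_root_def power_mult_distrib exp_of_nat_mult[symmetric] algebra_simps power_add)

text \<open>With \<open>e = (p + d) * c / p\<close>, which lies in \<open>[0, 1]\<close>, the derivative of the root is
  $(1 - c z^d)^{1/p - 1} (1 - e z^d)$. Both factors \<open>1 - c u\<close> and \<open>1 - e u\<close>
  have positive real part and imaginary parts of equal sign, so \<open>Re_principal_power_mult_pos\<close> applies with
  exponent \<open>1 - 1 / p\<close>.\<close>

lemma inj_on_binomial_root:
  assumes p: "p \<ge> 1" and d: "d \<ge> 1" and c: "0 \<le> c" "real (p + d) * c \<le> real p"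
  shows "inj_on (binomial_root p d c) unit_disc"
proof -
  define e where "e = real (p + d) * c / real p"
  have e: "0 \<le> e" "e \<le> 1" using p c by (auto simp: e_def)
  have "real p * c \<le> real p * 1" using c mult_right_mono[of "real p" "real (p + d)" c] by simp
  then have c1: "c \<le> 1" using p by simp
  define s where "s = 1 - 1 / real p"
  have s: "0 \<le> s" "s \<le> 1" using p by (auto simp: s_def)
  define a where "a = (\<lambda>z. 1 - complex_of_real c * z ^ d)"
  define b where "b = (\<lambda>z. 1 - complex_of_real e * z ^ d)"
  have a: "Re (a z) > 0" and b: "Re (b z) > 0" if "z \<in> unit_disc" for z
    using that Re_one_minus_pos c c1 d e by (auto simp: a_def b_def)
  have "sgn c = sgn e" using p c by (simp add: e_def sgn_mult)
  then have same: "sgn (Im (a z)) = sgn (Im (b z))" for z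
    by (simp add: a_def b_def sgn_mult sgn_minus)
  have deriv: "(binomial_root p d c has_field_derivative exp (- (of_real s * Ln (a z))) * b z) (at z)"
    if z: "z \<in> unit_disc" for z
  proof -
    have az: "a z \<noteq> 0" "a z \<notin> \<real>\<^sub>\<le>\<^sub>0" using a[OF z]
      by (auto simp: complex_nonpos_Reals_iff)
    have "(a has_field_derivative - (of_real c * (of_nat d * z ^ (d - 1)))) (at z)"
      unfolding a_def by (auto intro!: derivative_eq_intros)
    then have "((\<lambda>z. Ln (a z)) has_field_derivative
        inverse (a z) * - (of_real c * (of_nat d * z ^ (d - 1)))) (at z)"
      by (rule DERIV_chain2[where f = Ln and g = a, OF has_field_derivative_Ln[OF az(2)]])
    from DERIV_chain2[where f = exp, OF DERIV_exp DERIV_cdivide[OF this, of "of_nat p"]]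
    have "((\<lambda>z. z * exp (Ln (a z) / of_nat p)) has_field_derivative
        exp (Ln (a z) / of_nat p) + z * (exp (Ln (a z) / of_nat p) *
          ((- (of_real c * (of_nat d * z ^ (d - 1)))) / a z / of_nat p))) (at z)"
      by (rule DERIV_mult'[OF DERIV_ident, THEN DERIV_cong]) (simp add: field_simps)
    then have "(binomial_root p d c has_field_derivative
        exp (Ln (a z) / of_nat p) + z * (exp (Ln (a z) / of_nat p) *
          ((- (of_real c * (of_nat d * z ^ (d - 1)))) / a z / of_nat p))) (at z)"
      by (simp add: binomial_root_def[abs_def] a_def)
    also have "exp (Ln (a z) / of_nat p) + z * (exp (Ln (a z) / of_nat p) *
          ((- (of_real c * (of_nat d * z ^ (d - 1)))) / a z / of_nat p))
        = exp (Ln (a z) / of_nat p) / a z * (a z - of_real c * of_nat d * (z * z ^ (d - 1)) / of_nat p)"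
      using az p by (simp add: field_simps)
    also have "z * z ^ (d - 1) = z ^ d" using d by (simp add: power_eq_if)
    also have "a z - of_real c * of_nat d * z ^ d / of_nat p = b z"
      using p by (simp add: a_def b_def e_def field_simps)
    also have "exp (Ln (a z) / of_nat p) / a z = exp (- (of_real s * Ln (a z)))"
    proof -
      have "exp (Ln (a z) / of_nat p) / a z = exp (Ln (a z) / of_nat p - Ln (a z))"
        using az by (simp add: exp_diff)
      also have "Ln (a z) / of_nat p - Ln (a z) = - (of_real s * Ln (a z))"
        by (simp add: s_def algebra_simps)
      finally show ?thesis .
    qed
    finally show ?thesis .
  qed
  show ?thesis
  proof (rule inj_on_if_Re_derivative_pos[OF _ deriv])
    show "Re (exp (- (of_real s * Ln (a z))) * b z) > 0" if "z \<in> unit_disc" for z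
      using that a b same s by (intro Re_principal_power_mult_pos) auto
  qed auto
qed

text \<open>The coefficient condition says that the derivative $z^{p-1} (p - (p + d) c z^d)$ has no zero in the
  disc besides the origin, which makes every solution away from the origin a simple one.\<close>

lemma p_valent_binomial:
  assumes p: "p \<ge> 1" and d: "d \<ge> 1" and c: "0 \<le> c" "real (p + d) * c \<le> real p"
  shows "p_valent p (\<lambda>z. z ^ p - of_real c * z ^ (p + d))"
proof -
  define f where "f = (\<lambda>z. z ^ p - complex_of_real c * z ^ (p + d))"
  define g where "g = binomial_root p d c"
  have "real p * c \<le> real p * 1" using c mult_right_mono[of "real p" "real (p + d)" c] by simp
  then have c1: "c \<le> 1" using p by simp
  have nz: "1 - of_real c * z ^ d \<noteq> 0" if "z \<in> unit_disc" for z
    using Re_one_minus_pos[OF c(1) c1 d that] by (metis less_irrefl zero_complex.simps(1))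
  have fg: "f z = g z ^ p" if "z \<in> unit_disc" for z
    using binomial_root_power[OF p nz[OF that]] by (simp add: f_def g_def)
  have inj: "inj_on g unit_disc"
    unfolding g_def by (rule inj_on_binomial_root[OF p d c])
  have simple: "zorder (\<lambda>u. f u - w) z = 1" if z: "z \<in> unit_disc" "z \<noteq> 0" and w: "f z = w" for z w
  proof -
    define e where "e = real (p + d) * c / real p"
    have e: "0 \<le> e" "e \<le> 1" using p c by (auto simp: e_def)
    have "(f has_field_derivative of_nat p * z ^ (p - 1) * (1 - of_real e * z ^ d)) (at z)"
    proof -
      have "p + d - 1 = (p - 1) + d" using p by simp
      then have "z ^ (p + d - Suc 0) = z ^ (p - 1) * z ^ d" by (simp add: power_add)
      then show ?thesis unfolding f_def
        by (auto intro!: derivative_eq_intros) (use p in \<open>simp add: e_def field_simps\<close>)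
    qed
    then have "((\<lambda>u. f u - w) has_field_derivative
        of_nat p * z ^ (p - 1) * (1 - of_real e * z ^ d)) (at z)"
      by (auto intro!: derivative_eq_intros)
    then have "deriv (\<lambda>u. f u - w) z = of_nat p * z ^ (p - 1) * (1 - of_real e * z ^ d)"
      by (rule DERIV_imp_deriv)
    also have "\<dots> \<noteq> 0"
    proof -
      have "1 - of_real e * z ^ d \<noteq> 0"
        using Re_one_minus_pos[OF e d z(1)] by (metis less_irrefl zero_complex.simps(1))
      then show ?thesis using p z by simp
    qed
    finally have "deriv (\<lambda>u. f u - w) z \<noteq> 0" .
    then show ?thesis
      using w by (intro zorder_zero_eqI[where S = UNIV]) (auto simp: f_def intro!: holomorphic_intros)
  qed
  have zero: "preimages f 0 = {0}"
  proof -
    have "f z = z ^ p * (1 - of_real c * z ^ d)" for z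
      by (simp add: f_def power_add algebra_simps)
    then show ?thesis using nz p by (auto simp: preimages_def)
  qed
  have at0: "zorder (\<lambda>u. f u - 0) 0 = int p"
    by (rule zorder_eqI[where S = UNIV and g = "\<lambda>z. 1 - of_real c * z ^ d"])
       (use d in \<open>auto simp: f_def power_add power_0_left algebra_simps intro!: holomorphic_intros\<close>)
  have fin: "finite (preimages f w)" and bound: "card (preimages f w) \<le> card {x. x ^ p = w}" for w
  proof -
    have sub: "g ` preimages f w \<subseteq> {x. x ^ p = w}"
      using fg by (auto simp: preimages_def)
    have inj': "inj_on g (preimages f w)"
      using inj by (rule inj_on_subset) (auto simp: preimages_def)
    have fr: "finite {x::complex. x ^ p = w}" using p by (intro finite_nth_roots) auto
    show "finite (preimages f w)" using inj' sub fr by (rule inj_on_finite)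
    show "card (preimages f w) \<le> card {x. x ^ p = w}" using inj' sub fr by (rule card_inj_on_le)
  qed
  have "(\<Sum>z\<in>preimages f w. zorder (\<lambda>u. f u - w) z) \<le> int p" for w
  proof (cases "w = 0")
    case True
    then show ?thesis using zero at0 by simp
  next
    case False
    then have "z \<noteq> 0" if "z \<in> preimages f w" for z
      using that p by (auto simp: preimages_def f_def power_0_left)
    then have "(\<Sum>z\<in>preimages f w. zorder (\<lambda>u. f u - w) z) = (\<Sum>z\<in>preimages f w. 1)"
      by (intro sum.cong refl simple) (auto simp: preimages_def)
    then show ?thesis using bound[of w] card_nth_roots[OF False, of p] p by simp
  qed
  moreover have "(\<Sum>z\<in>preimages f 0. zorder (\<lambda>u. f u - 0) z) = int p"
    using zero at0 by simp
  ultimately show ?thesis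
    using fin unfolding p_valent_def f_def by blast
qed

section \<open>Quotients of a power series and its partial sums\<close>

text \<open>Let \<open>x = |z|\<close>, let \<open>S\<close> be the sum of the first \<open>M\<close> coefficients and \<open>T\<close> that of the others. Weights
  at least 1 and monotone turn the hypothesis into \<open>S + t M * T \<le> 1\<close>. As all exponents exceed \<open>p\<close>, the
  left-hand side is at most $t_M T x^{p+1} \le (1 - S) x^{p+1}$, and the right-hand side is at least
  $x^p - S x^{p+1}$; the difference of these two estimates is $x^p - x^{p+1} > 0$.\<close>

lemma tail_less_partial_sum:
  fixes b t :: "nat \<Rightarrow> real" and z s :: complex
  assumes "p < N" and b: "\<And>j. b j \<ge> 0" and t: "\<And>j. t j \<ge> 1" and "mono t"
    and summ: "summable (\<lambda>j. t j * b j)" and le1: "(\<Sum>j. t j * b j) \<le> 1"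
    and z: "z \<noteq> 0" "cmod z < 1"
    and s: "(\<lambda>j. of_real (b j) * z ^ (j + N)) sums s"
  shows "t M * cmod (s - (\<Sum>j<M. of_real (b j) * z ^ (j + N)))
       < cmod (z ^ p - (\<Sum>j<M. of_real (b j) * z ^ (j + N)))"
proof -
  define S where "S = (\<Sum>j<M. b j)"
  define T where "T = (\<Sum>j. b (j + M))"
  define x where "x = cmod z"
  have x: "0 < x" "x < 1" using z by (auto simp: x_def)
  have pow: "x ^ (j + N) \<le> x ^ Suc p" for j
    using x \<open>p < N\<close> by (intro power_decreasing) auto
  have term_le: "cmod (of_real (b j) * z ^ (j + N)) \<le> b j * x ^ Suc p" for j
    using b[of j] pow[of j] by (simp add: norm_mult norm_power x_def mult_left_mono del: power_Suc)
  have bt: "b j \<le> t j * b j" for j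
    using mult_right_mono[OF t[of j] b[of j]] by simp
  have sb: "summable b"
    using summ by (rule summable_comparison_test') (use b bt in auto)
  have sbM: "summable (\<lambda>j. b (j + M))" using sb by (simp add: summable_iff_shift)
  have tailb: "t M * T + S \<le> 1"
  proof -
    have "t M * T = (\<Sum>j. t M * b (j + M))"
      unfolding T_def by (rule suminf_mult[OF sbM, symmetric])
    also have "\<dots> \<le> (\<Sum>j. t (j + M) * b (j + M))"
    proof (rule suminf_le)
      show "t M * b (j + M) \<le> t (j + M) * b (j + M)" for j
        using \<open>mono t\<close> b by (intro mult_right_mono) (auto simp: mono_def)
      show "summable (\<lambda>j. t M * b (j + M))" using sbM by (rule summable_mult)
      show "summable (\<lambda>j. t (j + M) * b (j + M))"
        using summ summable_iff_shift[of "\<lambda>j. t j * b j" M] by simp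
    qed
    finally have "t M * T \<le> (\<Sum>j. t (j + M) * b (j + M))" .
    moreover have "S \<le> (\<Sum>j<M. t j * b j)" unfolding S_def by (intro sum_mono bt)
    moreover have "(\<Sum>j. t j * b j) = (\<Sum>j. t (j + M) * b (j + M)) + (\<Sum>j<M. t j * b j)"
      by (rule suminf_split_initial_segment[OF summ])
    ultimately show ?thesis using le1 by linarith
  qed
  have "cmod (s - (\<Sum>j<M. of_real (b j) * z ^ (j + N))) \<le> T * x ^ Suc p"
  proof -
    have "s - (\<Sum>j<M. of_real (b j) * z ^ (j + N)) = (\<Sum>j. of_real (b (j + M)) * z ^ (j + M + N))"
      using s sums_iff_shift'[of "\<lambda>j. of_real (b j) * z ^ (j + N)" M s] by (simp add: sums_iff)
    also have "cmod \<dots> \<le> (\<Sum>j. b (j + M) * x ^ Suc p)"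
      by (rule norm_suminf_le) (use term_le sbM in \<open>auto intro!: summable_mult2 simp del: power_Suc\<close>)
    also have "\<dots> = T * x ^ Suc p" unfolding T_def by (rule suminf_mult2[OF sbM, symmetric])
    finally show ?thesis .
  qed
  then have "t M * cmod (s - (\<Sum>j<M. of_real (b j) * z ^ (j + N))) \<le> t M * (T * x ^ Suc p)"
    using t[of M] by (intro mult_left_mono) auto
  also have "\<dots> \<le> (1 - S) * x ^ Suc p"
    using mult_right_mono[of "t M * T" "1 - S" "x ^ Suc p"] tailb x by (simp add: mult.assoc)
  also have "\<dots> < x ^ p - S * x ^ Suc p"
    using x by (simp add: algebra_simps)
  also have "\<dots> \<le> cmod (z ^ p) - cmod (\<Sum>j<M. of_real (b j) * z ^ (j + N))"
  proof -
    have "cmod (\<Sum>j<M. of_real (b j) * z ^ (j + N)) \<le> (\<Sum>j<M. b j * x ^ Suc p)"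
      by (rule sum_norm_le) (rule term_le)
    then show ?thesis by (simp add: S_def sum_distrib_right norm_power x_def)
  qed
  also have "\<dots> \<le> cmod (z ^ p - (\<Sum>j<M. of_real (b j) * z ^ (j + N)))"
    by (rule norm_triangle_ineq2)
  finally show ?thesis .
qed

text \<open>The image of the disc \<open>|w| < r\<close> under \<open>1 / (1 - w)\<close>, for \<open>r < 1\<close>, is the disc with diameter from
  \<open>1 / (1 + r)\<close> to \<open>1 / (1 - r)\<close>; with \<open>r = 1 / t\<close> the left end is the second bound.\<close>

lemma Re_quotients_gt:
  fixes K R :: complex and t :: real
  assumes t: "t > 1" and KR: "t * cmod R < cmod K"
  shows "Re ((K - R) / K) > 1 - 1 / t" and "Re (K / (K - R)) > t / (1 + t)"
proof -
  define w where "w = R / K"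
  define r where "r = 1 / t"
  have r: "0 < r" "r < 1" using t by (auto simp: r_def)
  have "0 \<le> t * cmod R" using t by simp
  then have K: "K \<noteq> 0" using KR by auto
  have w: "cmod w < r"
    using KR K t by (simp add: w_def r_def norm_divide field_simps)
  have x: "\<bar>Re w\<bar> < r" using w abs_Re_le_cmod[of w] by linarith
  have "(K - R) / K = 1 - w" using K by (simp add: w_def field_simps)
  then show "Re ((K - R) / K) > 1 - 1 / t" using x by (simp add: r_def)
  have w1: "1 - w \<noteq> 0" using x r by auto
  have eq: "K / (K - R) = 1 / (1 - w)" using K w1 by (simp add: w_def field_simps)
  have nn: "(cmod (1 - w))\<^sup>2 = 1 - 2 * Re w + (cmod w)\<^sup>2"
    unfolding cmod_power2 by (simp add: power2_eq_square algebra_simps)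
  \<comment> \<open>The sum of the next two inequalities is \<open>|w|\<^sup>2 < r + Re w - r * Re w\<close>, which is the
    claimed bound with the denominators cleared.\<close>
  have "(cmod w)\<^sup>2 < r\<^sup>2" using w by (intro power_strict_mono) auto
  moreover have "0 \<le> (1 - r) * (r + Re w)" using x r by (intro mult_nonneg_nonneg) auto
  ultimately have "(cmod (1 - w))\<^sup>2 < (1 + r) * (1 - Re w)"
    unfolding nn by (simp add: algebra_simps power2_eq_square)
  moreover have "(cmod (1 - w))\<^sup>2 > 0" using w1 by simp
  ultimately have "1 / (1 + r) < (1 - Re w) / (cmod (1 - w))\<^sup>2"
    using r by (simp add: divide_simps mult.commute)
  also have "\<dots> = Re (K / (K - R))"
    unfolding eq by (simp add: Re_divide cmod_power2)
  also have "1 / (1 + r) = t / (1 + t)" using t by (simp add: r_def field_simps)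
  finally show "Re (K / (K - R)) > t / (1 + t)" .
qed

section \<open>The weights\<close>

lemma Phi_ge_1_mono:
  assumes "lam \<ge> \<mu>" "\<mu> \<ge> 0" "l \<ge> 0" "\<delta> \<ge> 0" "p \<ge> 1" "p \<le> k" "k \<le> k'"
  shows "1 \<le> Phi p \<delta> lam \<mu> l k" and "Phi p \<delta> lam \<mu> l k \<le> Phi p \<delta> lam \<mu> l k'"
proof -
  define u where "u = (\<lambda>k. (real k - real p) * (lam * \<mu> * real k + lam - \<mu>))"
  have pl: "real p + l > 0" using assms by simp
  have lk: "0 \<le> lam * \<mu> * real k" using assms by simp
  then have u0: "0 \<le> u k"
    unfolding u_def using assms by (intro mult_nonneg_nonneg) linarith+
  have "lam * \<mu> * real k \<le> lam * \<mu> * real k'"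
    using assms by (intro mult_left_mono) auto
  then have uu: "u k \<le> u k'"
    unfolding u_def using assms lk by (intro mult_mono) linarith+
  have Phi: "Phi p \<delta> lam \<mu> l j = ((u j + (real p + l)) / (real p + l)) powr \<delta>" for j
    by (simp add: Phi_def u_def add.assoc)
  show "1 \<le> Phi p \<delta> lam \<mu> l k"
    unfolding Phi using u0 pl assms by (intro ge_one_powr_ge_zero) auto
  show "Phi p \<delta> lam \<mu> l k \<le> Phi p \<delta> lam \<mu> l k'"
    unfolding Phi using u0 uu pl assms by (intro powr_mono2 divide_right_mono) auto
qed

text \<open>Since \<open>A \<ge> -1\<close> and \<open>\<sigma> \<ge> 0\<close>, the denominator \<open>(B - A) * (p - \<sigma>)\<close> is at most \<open>(1 + B) * p\<close>. The lower bound
  \<open>k / p\<close> serves twice: it makes the weights larger than 1 for \<open>k > p\<close>, and for \<open>k = m + 1\<close> it is the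
  coefficient condition of \<open>p_valent_binomial\<close>.\<close>

lemma theta_bounds:
  assumes "lam \<ge> \<mu>" "\<mu> \<ge> 0" "l \<ge> 0" "\<delta> \<ge> 0" "p \<ge> 1" "-1 \<le> A" "A < B" "0 \<le> \<sigma>" "\<sigma> < real p"
    and "p \<le> k" "k \<le> k'"
  shows "real k / real p \<le> theta p \<delta> lam \<mu> l A B \<sigma> k"
    and "theta p \<delta> lam \<mu> l A B \<sigma> k \<le> theta p \<delta> lam \<mu> l A B \<sigma> k'"
proof -
  note Phi = Phi_ge_1_mono[OF assms(1-5,10,11)]
  have den: "0 < (B - A) * (real p - \<sigma>)" using assms by simp
  have "(B - A) * (real p - \<sigma>) \<le> (1 + B) * real p"
    using assms by (intro mult_mono) auto
  then have "real k * ((B - A) * (real p - \<sigma>)) \<le> real k * ((1 + B) * real p)"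
    by (intro mult_left_mono) auto
  also have "\<dots> \<le> real k * ((1 + B) * real p) * Phi p \<delta> lam \<mu> l k"
    using Phi(1) assms mult_left_mono[OF Phi(1), of "real k * ((1 + B) * real p)"] by simp
  finally show "real k / real p \<le> theta p \<delta> lam \<mu> l A B \<sigma> k"
    using den assms by (simp add: theta_def divide_simps mult_ac)
  show "theta p \<delta> lam \<mu> l A B \<sigma> k \<le> theta p \<delta> lam \<mu> l A B \<sigma> k'"
    unfolding theta_def using Phi den assms
    by (intro divide_right_mono mult_mono) auto
qed

section \<open>The bounds and their sharpness\<close>

lemma kappa_eq_initial_segment:
  assumes "m \<ge> n + p"
  shows "kappa n p a m z =
    z ^ p - (\<Sum>j<m + 1 - (n + p). of_real (cmod (a (j + (n + p)))) * z ^ (j + (n + p)))"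
proof -
  have "(\<Sum>k=n+p..m. of_real (cmod (a k)) * z ^ k)
      = (\<Sum>j<m + 1 - (n + p). of_real (cmod (a (j + (n + p)))) * z ^ (j + (n + p)))"
    by (rule sum.reindex_bij_witness[of _ "\<lambda>j. j + (n + p)" "\<lambda>k. k - (n + p)"])
       (use assms in auto)
  then show ?thesis using assms by (simp add: kappa_def)
qed

lemma partial_sum_quotient_bounds:
  assumes n: "n \<ge> 1" and gt1: "\<And>k. k \<ge> n + p \<Longrightarrow> t k > 1"
    and mono: "\<And>k k'. n + p \<le> k \<Longrightarrow> k \<le> k' \<Longrightarrow> t k \<le> t k'"
    and f: "neg_coeff_function n p a f" and bound: "weighted_coeff_bound n p t a"
    and m: "m \<ge> n + p" and z: "z \<in> unit_disc"
  shows "Re (ext_quotient f (kappa n p a m) z) > 1 - 1 / t (m + 1)"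
    and "Re (ext_quotient (kappa n p a m) f z) > t (m + 1) / (1 + t (m + 1))"
proof -
  define M where "M = m + 1 - (n + p)"
  define K where "K = kappa n p a m z"
  define R where "R = z ^ p - f z - (\<Sum>j<M. of_real (cmod (a (j + (n + p)))) * z ^ (j + (n + p)))"
  have K: "K = z ^ p - (\<Sum>j<M. of_real (cmod (a (j + (n + p)))) * z ^ (j + (n + p)))"
    unfolding K_def M_def by (rule kappa_eq_initial_segment[OF m])
  have fz: "f z = K - R" by (simp add: K R_def)
  have tM: "t (M + (n + p)) = t (m + 1)" using m by (simp add: M_def)
  have t1: "t (m + 1) > 1" using gt1[of "m + 1"] m by simp
  have "Re (ext_quotient f (kappa n p a m) z) > 1 - 1 / t (m + 1)
      \<and> Re (ext_quotient (kappa n p a m) f z) > t (m + 1) / (1 + t (m + 1))"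
  proof (cases "z = 0")
    case True
    then show ?thesis using t1 by (simp add: ext_quotient_def)
  next
    case False
    have "t (M + (n + p)) * cmod R < cmod K"
      unfolding K R_def
    proof (rule tail_less_partial_sum[where t = "\<lambda>j. t (j + (n + p))"])
      show "mono (\<lambda>j. t (j + (n + p)))" by (intro monoI mono) auto
      show "1 \<le> t (j + (n + p))" for j using gt1[of "j + (n + p)"] by simp
    qed (use n f bound z False in \<open>auto simp: neg_coeff_function_def weighted_coeff_bound_def\<close>)
    then have "t (m + 1) * cmod R < cmod K" by (simp add: tM)
    from Re_quotients_gt[OF t1 this] show ?thesis
      using False by (simp add: ext_quotient_def fz flip: K_def)
  qed
  then show "Re (ext_quotient f (kappa n p a m) z) > 1 - 1 / t (m + 1)"
    and "Re (ext_quotient (kappa n p a m) f z) > t (m + 1) / (1 + t (m + 1))" by auto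
qed

lemma sums_single_shifted:
  fixes g :: "nat \<Rightarrow> 'a :: real_normed_vector"
  assumes "m + 1 \<ge> N" and "\<And>k. k \<noteq> m + 1 \<Longrightarrow> g k = 0"
  shows "(\<lambda>j. g (j + N)) sums g (m + 1)"
proof -
  have "(\<lambda>j. g (j + N)) sums (\<Sum>j\<in>{m + 1 - N}. g (j + N))"
    using assms by (intro sums_finite) auto
  then show ?thesis using assms(1) by simp
qed

lemma extremal_fun_in_class:
  assumes p: "p \<ge> 1" and m: "m \<ge> n + p" and t: "t (m + 1) \<ge> real (m + 1) / real p"
  shows "neg_coeff_function n p (extremal_coeff t m) (extremal_fun p t m)"
    and "weighted_coeff_bound n p t (extremal_coeff t m)"
proof -
  define c where "c = 1 / t (m + 1)"
  have "real (m + 1) / real p > 0" using p by simp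
  then have tpos: "t (m + 1) > 0" using t by linarith
  have c: "0 \<le> c" "real (m + 1) * c \<le> real p"
    using tpos t p by (auto simp: c_def field_simps)
  define d where "d = m + 1 - p"
  have d: "d \<ge> 1" "p + d = m + 1" using m by (auto simp: d_def)
  have f: "extremal_fun p t m = (\<lambda>z. z ^ p - of_real c * z ^ (m + 1))"
    by (simp add: extremal_fun_def c_def fun_eq_iff)
  have coeff: "extremal_coeff t m k = (if k = m + 1 then of_real c else 0)" for k
    by (simp add: extremal_coeff_def c_def)
  have N: "n + p \<le> m + 1" using m by simp
  have sums: "(\<lambda>j. of_real (cmod (extremal_coeff t m (j + (n + p)))) * z ^ (j + (n + p)))
      sums (z ^ p - extremal_fun p t m z)" for z
    using sums_single_shifted[OF N, of "\<lambda>k. of_real (cmod (extremal_coeff t m k)) * z ^ k"] c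
    by (simp add: coeff f)
  have "(\<lambda>j. - extremal_coeff t m (j + (n + p)) * z ^ (j + (n + p)))
      sums (extremal_fun p t m z - z ^ p)" for z
    using sums_single_shifted[OF N, of "\<lambda>k. - extremal_coeff t m k * z ^ k"]
    by (simp add: coeff f)
  moreover have "p_valent p (extremal_fun p t m)"
    using p_valent_binomial[OF p d(1) c(1)] c(2) unfolding f d(2) by blast
  moreover have "extremal_fun p t m analytic_on unit_disc"
    unfolding f by (auto intro!: analytic_intros)
  ultimately have "extremal_fun p t m \<in> class_A n p"
    unfolding class_A_def by (auto intro!: exI[where x = "\<lambda>k. - extremal_coeff t m k"])
  then show "neg_coeff_function n p (extremal_coeff t m) (extremal_fun p t m)"
    unfolding neg_coeff_function_def using sums by blast
  have "(\<lambda>j. t (j + (n + p)) * cmod (extremal_coeff t m (j + (n + p)))) sums 1"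
    using sums_single_shifted[OF N, of "\<lambda>k. t k * cmod (extremal_coeff t m k)"] tpos
    by (simp add: coeff c_def norm_divide)
  then show "weighted_coeff_bound n p t (extremal_coeff t m)"
    by (simp add: weighted_coeff_bound_def sums_iff)
qed

lemma kappa_extremal: "kappa n p (extremal_coeff t m) m z = z ^ p"
  by (simp add: kappa_def extremal_coeff_def)

lemma ex_root_in_unit_disc:
  assumes "d \<ge> 1" "u \<noteq> 0" "cmod u < 1"
  shows "\<exists>z\<in>unit_disc. z \<noteq> 0 \<and> z ^ d = u"
proof -
  have "card {z. z ^ d = u} = d" using assms by (intro card_nth_roots) auto
  then have "{z. z ^ d = u} \<noteq> {}" using assms by force
  then obtain z where z: "z ^ d = u" by blast
  then have "cmod z ^ d < 1" using assms by (simp flip: norm_power)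
  then have "cmod z < 1" using assms by (simp add: power_less_one_iff)
  then show ?thesis using z assms by (intro bexI[of _ z]) auto
qed

lemma extremal_quotients:
  assumes "z \<noteq> 0" "m \<ge> p"
  shows "ext_quotient (extremal_fun p t m) (kappa n p (extremal_coeff t m) m) z
       = 1 - of_real (1 / t (m + 1)) * z ^ (m + 1 - p)"
    and "ext_quotient (kappa n p (extremal_coeff t m) m) (extremal_fun p t m) z
       = 1 / (1 - of_real (1 / t (m + 1)) * z ^ (m + 1 - p))"
proof -
  have "z ^ (m + 1) = z ^ p * z ^ (m + 1 - p)" using assms by (simp flip: power_add)
  then have f: "extremal_fun p t m z = z ^ p * (1 - of_real (1 / t (m + 1)) * z ^ (m + 1 - p))"
    unfolding extremal_fun_def by (simp only: right_diff_distrib) simp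
  show "ext_quotient (extremal_fun p t m) (kappa n p (extremal_coeff t m) m) z
       = 1 - of_real (1 / t (m + 1)) * z ^ (m + 1 - p)"
    and "ext_quotient (kappa n p (extremal_coeff t m) m) (extremal_fun p t m) z
       = 1 / (1 - of_real (1 / t (m + 1)) * z ^ (m + 1 - p))"
    using assms(1) by (auto simp: ext_quotient_def kappa_extremal f)
qed

text \<open>The infima are approached as $z^{m+1-p}$ tends to 1 for the first quotient and to -1 for the second.
  The real number \<open>s\<close> below is the absolute value of that power, taken close enough to 1.\<close>

lemma partial_sum_quotient_bounds_sharp:
  assumes m: "m \<ge> p" and t: "t (m + 1) > 0"
  shows "c > 1 - 1 / t (m + 1) \<Longrightarrow> \<exists>z\<in>unit_disc.
           Re (ext_quotient (extremal_fun p t m) (kappa n p (extremal_coeff t m) m) z) < c"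
    and "c > t (m + 1) / (1 + t (m + 1)) \<Longrightarrow> \<exists>z\<in>unit_disc.
           Re (ext_quotient (kappa n p (extremal_coeff t m) m) (extremal_fun p t m) z) < c"
proof -
  define T where "T = t (m + 1)"
  have T: "T > 0" using t by (simp add: T_def)
  have d: "m + 1 - p \<ge> 1" using m by simp
  {
    assume "c > 1 - 1 / t (m + 1)"
    then have "T * (1 - c) < 1" using T by (simp add: T_def field_simps)
    then have "max 0 (T * (1 - c)) < 1" by simp
    then obtain s where s: "max 0 (T * (1 - c)) < s" "s < 1" using dense by blast
    then obtain z where z: "z \<in> unit_disc" "z \<noteq> 0" "z ^ (m + 1 - p) = of_real s"
      using ex_root_in_unit_disc[OF d, of "of_real s"] by auto
    have "1 - s / T < c" using s T by (simp add: field_simps)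
    then have "Re (1 - of_real (1 / T) * of_real s) < c" by simp
    then show "\<exists>z\<in>unit_disc.
           Re (ext_quotient (extremal_fun p t m) (kappa n p (extremal_coeff t m) m) z) < c"
      using z extremal_quotients(1)[OF z(2) m, of t n] unfolding T_def by metis
  next
    assume c: "c > t (m + 1) / (1 + t (m + 1))"
    have "T / (1 + T) > 0" using T by simp
    then have c0: "c > 0" using c unfolding T_def by linarith
    have "T * (1 / c - 1) < 1" using c c0 T by (simp add: T_def field_simps)
    then have "max 0 (T * (1 / c - 1)) < 1" by simp
    then obtain s where s: "max 0 (T * (1 / c - 1)) < s" "s < 1" using dense by blast
    then obtain z where z: "z \<in> unit_disc" "z \<noteq> 0" "z ^ (m + 1 - p) = of_real (- s)"
      using ex_root_in_unit_disc[OF d, of "of_real (- s)"] by auto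
    have "1 / c < 1 + s / T" using s T by (simp add: field_simps)
    then have "1 / (1 + s / T) < c" using c0 s T
      by (simp add: field_simps)
    moreover have "1 / (1 - of_real (1 / T) * of_real (- s)) = complex_of_real (1 / (1 + s / T))"
      by simp
    ultimately have "Re (1 / (1 - of_real (1 / T) * of_real (- s))) < c" by (metis Re_complex_of_real)
    then show "\<exists>z\<in>unit_disc.
           Re (ext_quotient (kappa n p (extremal_coeff t m) m) (extremal_fun p t m) z) < c"
      using z extremal_quotients(2)[OF z(2) m, of n t] unfolding T_def by metis
  }
qed

theorem theorem5p1:
  fixes n p :: nat and lam \<mu> l \<delta> A B \<sigma> :: real
  defines "\<theta> \<equiv> theta p \<delta> lam \<mu> l A B \<sigma>"
  assumes "n \<ge> 1" and "p \<ge> 1"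
    and "lam \<ge> \<mu>" and "\<mu> \<ge> 0" and "l \<ge> 0" and "\<delta> \<ge> 0"
    and "-1 \<le> A" and "A < B" and "B \<le> 1" and "0 < B"
    and "0 \<le> \<sigma>" and "\<sigma> < real p"
  shows "(\<forall>a f. neg_coeff_function n p a f \<longrightarrow> weighted_coeff_bound n p \<theta> a \<longrightarrow>
            (\<forall>m\<ge>n + p. \<forall>z\<in>unit_disc.
               Re (ext_quotient f (kappa n p a m) z) > 1 - 1 / \<theta> (m + 1) \<and>
               Re (ext_quotient (kappa n p a m) f z) > \<theta> (m + 1) / (1 + \<theta> (m + 1))))
       \<and> (\<forall>m\<ge>n + p.
            neg_coeff_function n p (extremal_coeff \<theta> m) (extremal_fun p \<theta> m) \<and>
            weighted_coeff_bound n p \<theta> (extremal_coeff \<theta> m) \<and>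
            (\<forall>c > 1 - 1 / \<theta> (m + 1). \<exists>z\<in>unit_disc.
               Re (ext_quotient (extremal_fun p \<theta> m) (kappa n p (extremal_coeff \<theta> m) m) z) < c) \<and>
            (\<forall>c > \<theta> (m + 1) / (1 + \<theta> (m + 1)). \<exists>z\<in>unit_disc.
               Re (ext_quotient (kappa n p (extremal_coeff \<theta> m) m) (extremal_fun p \<theta> m) z) < c))"
proof -
  have ge: "real k / real p \<le> \<theta> k" if "k \<ge> p" for k
    unfolding \<theta>_def using that assms by (intro theta_bounds(1)) auto
  have mono: "\<theta> k \<le> \<theta> k'" if "n + p \<le> k" "k \<le> k'" for k k'
    unfolding \<theta>_def using that assms by (intro theta_bounds(2)) auto
  have gt1: "\<theta> k > 1" if "k \<ge> n + p" for k
  proof -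
    have "1 < real k / real p" using that \<open>n \<ge> 1\<close> \<open>p \<ge> 1\<close> by (simp add: field_simps)
    then show ?thesis using ge[of k] that by linarith
  qed
  show ?thesis
  proof (intro conjI allI impI ballI)
    fix a f m z
    assume "neg_coeff_function n p a f" "weighted_coeff_bound n p \<theta> a" "m \<ge> n + p" "z \<in> unit_disc"
    note * = partial_sum_quotient_bounds[OF \<open>n \<ge> 1\<close> gt1 mono this]
    show "Re (ext_quotient f (kappa n p a m) z) > 1 - 1 / \<theta> (m + 1)"
      and "Re (ext_quotient (kappa n p a m) f z) > \<theta> (m + 1) / (1 + \<theta> (m + 1))"
      using * by auto
  next
    fix m assume m: "m \<ge> n + p"
    have "\<theta> (m + 1) \<ge> real (m + 1) / real p" using m by (intro ge) auto
    note * = extremal_fun_in_class[OF \<open>p \<ge> 1\<close> m, of \<theta>, OF this]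
    show "neg_coeff_function n p (extremal_coeff \<theta> m) (extremal_fun p \<theta> m)" by (rule *(1))
    show "weighted_coeff_bound n p \<theta> (extremal_coeff \<theta> m)" by (rule *(2))
    have mp: "m \<ge> p" using m by simp
    have pos: "\<theta> (m + 1) > 0" using gt1[of "m + 1"] m by simp
    note ** = partial_sum_quotient_bounds_sharp[OF mp, of \<theta>, OF pos]
    fix c
    show "\<exists>z\<in>unit_disc.
        Re (ext_quotient (extremal_fun p \<theta> m) (kappa n p (extremal_coeff \<theta> m) m) z) < c"
      if "c > 1 - 1 / \<theta> (m + 1)" using **(1)[OF that] .
    show "\<exists>z\<in>unit_disc.
        Re (ext_quotient (kappa n p (extremal_coeff \<theta> m) m) (extremal_fun p \<theta> m) z) < c"
      if "c > \<theta> (m + 1) / (1 + \<theta> (m + 1))" using **(2)[OF that] .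
  qed
qed

end
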